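(* Let $L$ be either of the sequent calculi $\mathrm{lTS4}$ or $\mathrm{gTS4}$ defined in the context. Then the rules ($\neg$left$^{-1}$) $\Gamma\Rightarrow\Delta,\neg\alpha$ / $\alpha,\Gamma\Rightarrow\Delta$ and ($\neg$right$^{-1}$) $\neg\alpha,\Gamma\Rightarrow\Delta$ / $\Gamma\Rightarrow\Delta,\alpha$ are admissible in cut-free $L$.
   Context: Formulas are built from countably many propositional variables using the binary connectives $\wedge,\vee,\to$ and the unary connectives $\neg,\Box,\Diamond$. Letters $\Gamma,\Delta$ (possibly with subscripts) denote finite, possibly empty, sets of formulas; a sequent is an expression $\Gamma\Rightarrow\Delta$; a comma denotes union. For a word $w$ over $\{\neg,\Box,\Diamond\}$, $w\Gamma=\{w\gamma:\gamma\in\Gamma\}$. A rule "$S_1;\dots;S_n\,/\,S$" has premises $S_1,\dots,S_n$ and conclusion $S$. "Cut-free $L$" means the system $L$ with the rule (cut) removed. A rule $R$ is admissible in a calculus $M$ if for every instance of $R$ with premises $S_1,\dots,S_n$ and conclusion $S$, whenever every $S_i$ is provable in $M$, $S$ is provable in $M$. The calculus lTS4. Initial sequents: for every propositional variable $p$: $p\Rightarrow p$, $\neg p\Rightarrow\neg p$, $\neg p,p\Rightarrow$, and $\Rightarrow\neg p,p$. Structural rules: (cut) $\Gamma\Rightarrow\alpha$; $\alpha,\Gamma\Rightarrow\Delta$ / $\Gamma\Rightarrow\Delta$. (we-left) $\Gamma\Rightarrow\Delta$ / $\alpha,\Gamma\Rightarrow\Delta$. (we-right) $\Gamma\Rightarrow\Delta$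 / $\Gamma\Rightarrow\Delta,\alpha$. Non-twist logical rules: ($\wedge$left) $\alpha,\beta,\Gamma\Rightarrow\Delta$ / $\alpha\wedge\beta,\Gamma\Rightarrow\Delta$. ($\wedge$right) $\Gamma\Rightarrow\Delta,\alpha$; $\Gamma\Rightarrow\Delta,\beta$ / $\Gamma\Rightarrow\Delta,\alpha\wedge\beta$. ($\vee$left) $\alpha,\Gamma\Rightarrow\Delta$; $\beta,\Gamma\Rightarrow\Delta$ / $\alpha\vee\beta,\Gamma\Rightarrow\Delta$. ($\vee$right) $\Gamma\Rightarrow\Delta,\alpha,\beta$ / $\Gamma\Rightarrow\Delta,\alpha\vee\beta$. ($\to$left) $\Gamma\Rightarrow\Delta,\alpha$; $\beta,\Gamma\Rightarrow\Delta$ / $\alpha\to\beta,\Gamma\Rightarrow\Delta$. ($\to$right) $\alpha,\Gamma\Rightarrow\Delta,\beta$ / $\Gamma\Rightarrow\Delta,\alpha\to\beta$. ($\Box$left) $\alpha,\Gamma\Rightarrow\Delta$ / $\Box\alpha,\Gamma\Rightarrow\Delta$. ($\Box$right) $\Box\Gamma_1,\neg\Diamond\Gamma_2\Rightarrow\Diamond\Delta_1,\neg\Box\Delta_2,\alpha$ / $\Box\Gamma_1,\neg\Diamond\Gamma_2\Rightarrow\Diamond\Delta_1,\neg\Box\Delta_2,\Box\alpha$. ($\Diamond$left) $\alpha,\Box\Gamma_1,\neg\Diamond\Gamma_2\Rightarrow\Diamond\Delta_1,\neg\Box\Delta_2$ / $\Diamond\alpha,\Box\Gamma_1,\neg\Diamond\Gamma_2\Rightarrow\Diamond\Delta_1,\neg\Box\Delta_2$.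 ($\Diamond$right) $\Gamma\Rightarrow\Delta,\alpha$ / $\Gamma\Rightarrow\Delta,\Diamond\alpha$. Twist rules: ($\neg\neg$left$^t$) $\alpha,\Gamma\Rightarrow\Delta$ / $\neg\neg\alpha,\Gamma\Rightarrow\Delta$. ($\neg\neg$right$^t$) $\Gamma\Rightarrow\Delta,\alpha$ / $\Gamma\Rightarrow\Delta,\neg\neg\alpha$. ($\neg\wedge$left$^t$) $\Gamma\Rightarrow\Delta,\alpha$; $\Gamma\Rightarrow\Delta,\beta$ / $\neg(\alpha\wedge\beta),\Gamma\Rightarrow\Delta$. ($\neg\wedge$right$^t$) $\alpha,\beta,\Gamma\Rightarrow\Delta$ / $\Gamma\Rightarrow\Delta,\neg(\alpha\wedge\beta)$. ($\neg\vee$left$^t$) $\Gamma\Rightarrow\Delta,\alpha,\beta$ / $\neg(\alpha\vee\beta),\Gamma\Rightarrow\Delta$. ($\neg\vee$right$^t$) $\alpha,\Gamma\Rightarrow\Delta$; $\beta,\Gamma\Rightarrow\Delta$ / $\Gamma\Rightarrow\Delta,\neg(\alpha\vee\beta)$. ($\neg\to$left$^t$) $\alpha,\Gamma\Rightarrow\Delta,\beta$ / $\neg(\alpha\to\beta),\Gamma\Rightarrow\Delta$. ($\neg\to$right$^t$) $\Gamma\Rightarrow\Delta,\alpha$; $\beta,\Gamma\Rightarrow\Delta$ / $\Gamma\Rightarrow\Delta,\neg(\alpha\to\beta)$. ($\neg\Box$left$^t$) $\Box\Gamma_1,\neg\Diamond\Gamma_2\Rightarrow\Diamond\Delta_1,\neg\Box\Delta_2,\alpha$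 / $\neg\Box\alpha,\Box\Gamma_1,\neg\Diamond\Gamma_2\Rightarrow\Diamond\Delta_1,\neg\Box\Delta_2$. ($\neg\Box$right$^t$) $\alpha,\Gamma\Rightarrow\Delta$ / $\Gamma\Rightarrow\Delta,\neg\Box\alpha$. ($\neg\Diamond$left$^t$) $\Gamma\Rightarrow\Delta,\alpha$ / $\neg\Diamond\alpha,\Gamma\Rightarrow\Delta$. ($\neg\Diamond$right$^t$) $\alpha,\Box\Gamma_1,\neg\Diamond\Gamma_2\Rightarrow\Diamond\Delta_1,\neg\Box\Delta_2$ / $\Box\Gamma_1,\neg\Diamond\Gamma_2\Rightarrow\Diamond\Delta_1,\neg\Box\Delta_2,\neg\Diamond\alpha$. The calculus gTS4 is obtained from lTS4 by replacing ($\Box$right), ($\Diamond$left), ($\neg\Box$left$^t$), ($\neg\Diamond$right$^t$) with: ($\Box$right$^T$) $\Box\Gamma_1,\Box\Delta_2\Rightarrow\Diamond\Delta_1,\Diamond\Gamma_2,\alpha$ / $\Box\Gamma_1,\neg\Diamond\Gamma_2\Rightarrow\Diamond\Delta_1,\neg\Box\Delta_2,\Box\alpha$. ($\Diamond$left$^T$) $\alpha,\Box\Gamma_1,\Box\Delta_2\Rightarrow\Diamond\Delta_1,\Diamond\Gamma_2$ / $\Diamond\alpha,\Box\Gamma_1,\neg\Diamond\Gamma_2\Rightarrow\Diamond\Delta_1,\neg\Box\Delta_2$. ($\neg\Box$left$^T$) $\Box\Gamma_1,\Box\Delta_2\Rightarrow\Diamond\Delta_1,\Diamond\Gamma_2,\alpha$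 / $\neg\Box\alpha,\Box\Gamma_1,\neg\Diamond\Gamma_2\Rightarrow\Diamond\Delta_1,\neg\Box\Delta_2$. ($\neg\Diamond$right$^T$) $\alpha,\Box\Gamma_1,\Box\Delta_2\Rightarrow\Diamond\Delta_1,\Diamond\Gamma_2$ / $\Box\Gamma_1,\neg\Diamond\Gamma_2\Rightarrow\Diamond\Delta_1,\neg\Box\Delta_2,\neg\Diamond\alpha$. (All other rules and initial sequents of lTS4, including ($\neg\Diamond$left$^t$), are kept.) *)

theory Defs
  imports Main "HOL-Library.FSet"
begin

datatype fm =
    Var nat
  | And fm fm  (infixr "\<^bold>\<and>" 75)
  | Or fm fm   (infixr "\<^bold>\<or>" 74)
  | Imp fm fm  (infixr "\<^bold>\<rightarrow>" 73)
  | Neg fm     ("\<^bold>\<not>_" [80] 80)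
  | Box fm     ("\<box>_" [80] 80)
  | Dia fm     ("\<diamond>_" [80] 80)

datatype sequent = Sequent "fm fset" "fm fset"  (infix "\<Rrightarrow>" 50)

inductive initial :: "sequent \<Rightarrow> bool" where
  "initial ({|Var p|} \<Rrightarrow> {|Var p|})"
| "initial ({|\<^bold>\<not>Var p|} \<Rrightarrow> {|\<^bold>\<not>Var p|})"
| "initial ({|\<^bold>\<not>Var p, Var p|} \<Rrightarrow> {||})"
| "initial ({||} \<Rrightarrow> {|\<^bold>\<not>Var p, Var p|})"

text \<open>
  Rules are referred to by name, so that a calculus is a set of names and a rule can be removed
  from it. The suffix \<open>T\<close> marks the four modal rules that are specific to gTS4.
\<close>

datatype rule_name =
    Cut | WeL | WeR | AndL | AndR | OrL
  | OrR | ImpL | ImpR | BoxL | BoxR | DiaL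
  | DiaR | NegNegL | NegNegR | NegAndL | NegAndR | NegOrL
  | NegOrR | NegImpL | NegImpR | NegBoxL | NegBoxR | NegDiaL
  | NegDiaR | BoxRT | DiaLT | NegBoxLT | NegDiaRT

text \<open>
  \<open>rule_inst r Ps S\<close>: the sequents \<open>Ps\<close> over \<open>S\<close> form an instance of the rule named \<open>r\<close>.
  As sequents consist of sets, an active formula may also occur in the context.
\<close>

inductive rule_inst :: "rule_name \<Rightarrow> sequent list \<Rightarrow> sequent \<Rightarrow> bool" where
  "rule_inst Cut
     [\<Gamma> \<Rrightarrow> {|\<alpha>|},
      finsert \<alpha> \<Gamma> \<Rrightarrow> \<Delta>]
     (\<Gamma> \<Rrightarrow> \<Delta>)"
| "rule_inst WeL
     [\<Gamma> \<Rrightarrow> \<Delta>]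
     (finsert \<alpha> \<Gamma> \<Rrightarrow> \<Delta>)"
| "rule_inst WeR
     [\<Gamma> \<Rrightarrow> \<Delta>]
     (\<Gamma> \<Rrightarrow> finsert \<alpha> \<Delta>)"
| "rule_inst AndL
     [finsert \<alpha> (finsert \<beta> \<Gamma>) \<Rrightarrow> \<Delta>]
     (finsert (\<alpha> \<^bold>\<and> \<beta>) \<Gamma> \<Rrightarrow> \<Delta>)"
| "rule_inst AndR
     [\<Gamma> \<Rrightarrow> finsert \<alpha> \<Delta>,
      \<Gamma> \<Rrightarrow> finsert \<beta> \<Delta>]
     (\<Gamma> \<Rrightarrow> finsert (\<alpha> \<^bold>\<and> \<beta>) \<Delta>)"
| "rule_inst OrL
     [finsert \<alpha> \<Gamma> \<Rrightarrow> \<Delta>,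
      finsert \<beta> \<Gamma> \<Rrightarrow> \<Delta>]
     (finsert (\<alpha> \<^bold>\<or> \<beta>) \<Gamma> \<Rrightarrow> \<Delta>)"
| "rule_inst OrR
     [\<Gamma> \<Rrightarrow> finsert \<alpha> (finsert \<beta> \<Delta>)]
     (\<Gamma> \<Rrightarrow> finsert (\<alpha> \<^bold>\<or> \<beta>) \<Delta>)"
| "rule_inst ImpL
     [\<Gamma> \<Rrightarrow> finsert \<alpha> \<Delta>,
      finsert \<beta> \<Gamma> \<Rrightarrow> \<Delta>]
     (finsert (\<alpha> \<^bold>\<rightarrow> \<beta>) \<Gamma> \<Rrightarrow> \<Delta>)"
| "rule_inst ImpR
     [finsert \<alpha> \<Gamma> \<Rrightarrow> finsert \<beta> \<Delta>]
     (\<Gamma> \<Rrightarrow> finsert (\<alpha> \<^bold>\<rightarrow> \<beta>) \<Delta>)"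
| "rule_inst BoxL
     [finsert \<alpha> \<Gamma> \<Rrightarrow> \<Delta>]
     (finsert (\<box>\<alpha>) \<Gamma> \<Rrightarrow> \<Delta>)"
| "rule_inst BoxR
     [Box |`| \<Gamma>\<^sub>1 |\<union>| Neg |`| Dia |`| \<Gamma>\<^sub>2 \<Rrightarrow> finsert \<alpha> (Dia |`| \<Delta>\<^sub>1 |\<union>| Neg |`| Box |`| \<Delta>\<^sub>2)]
     (Box |`| \<Gamma>\<^sub>1 |\<union>| Neg |`| Dia |`| \<Gamma>\<^sub>2 \<Rrightarrow> finsert (\<box>\<alpha>) (Dia |`| \<Delta>\<^sub>1 |\<union>| Neg |`| Box |`| \<Delta>\<^sub>2))"
| "rule_inst DiaL
     [finsert \<alpha> (Box |`| \<Gamma>\<^sub>1 |\<union>| Neg |`| Dia |`| \<Gamma>\<^sub>2) \<Rrightarrow> Dia |`| \<Delta>\<^sub>1 |\<union>| Neg |`| Box |`| \<Delta>\<^sub>2]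
     (finsert (\<diamond>\<alpha>) (Box |`| \<Gamma>\<^sub>1 |\<union>| Neg |`| Dia |`| \<Gamma>\<^sub>2) \<Rrightarrow> Dia |`| \<Delta>\<^sub>1 |\<union>| Neg |`| Box |`| \<Delta>\<^sub>2)"
| "rule_inst DiaR
     [\<Gamma> \<Rrightarrow> finsert \<alpha> \<Delta>]
     (\<Gamma> \<Rrightarrow> finsert (\<diamond>\<alpha>) \<Delta>)"
| "rule_inst NegNegL
     [finsert \<alpha> \<Gamma> \<Rrightarrow> \<Delta>]
     (finsert (\<^bold>\<not>\<^bold>\<not>\<alpha>) \<Gamma> \<Rrightarrow> \<Delta>)"
| "rule_inst NegNegR
     [\<Gamma> \<Rrightarrow> finsert \<alpha> \<Delta>]
     (\<Gamma> \<Rrightarrow> finsert (\<^bold>\<not>\<^bold>\<not>\<alpha>) \<Delta>)"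
| "rule_inst NegAndL
     [\<Gamma> \<Rrightarrow> finsert \<alpha> \<Delta>,
      \<Gamma> \<Rrightarrow> finsert \<beta> \<Delta>]
     (finsert (\<^bold>\<not>(\<alpha> \<^bold>\<and> \<beta>)) \<Gamma> \<Rrightarrow> \<Delta>)"
| "rule_inst NegAndR
     [finsert \<alpha> (finsert \<beta> \<Gamma>) \<Rrightarrow> \<Delta>]
     (\<Gamma> \<Rrightarrow> finsert (\<^bold>\<not>(\<alpha> \<^bold>\<and> \<beta>)) \<Delta>)"
| "rule_inst NegOrL
     [\<Gamma> \<Rrightarrow> finsert \<alpha> (finsert \<beta> \<Delta>)]
     (finsert (\<^bold>\<not>(\<alpha> \<^bold>\<or> \<beta>)) \<Gamma> \<Rrightarrow> \<Delta>)"
| "rule_inst NegOrR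
     [finsert \<alpha> \<Gamma> \<Rrightarrow> \<Delta>,
      finsert \<beta> \<Gamma> \<Rrightarrow> \<Delta>]
     (\<Gamma> \<Rrightarrow> finsert (\<^bold>\<not>(\<alpha> \<^bold>\<or> \<beta>)) \<Delta>)"
| "rule_inst NegImpL
     [finsert \<alpha> \<Gamma> \<Rrightarrow> finsert \<beta> \<Delta>]
     (finsert (\<^bold>\<not>(\<alpha> \<^bold>\<rightarrow> \<beta>)) \<Gamma> \<Rrightarrow> \<Delta>)"
| "rule_inst NegImpR
     [\<Gamma> \<Rrightarrow> finsert \<alpha> \<Delta>,
      finsert \<beta> \<Gamma> \<Rrightarrow> \<Delta>]
     (\<Gamma> \<Rrightarrow> finsert (\<^bold>\<not>(\<alpha> \<^bold>\<rightarrow> \<beta>)) \<Delta>)"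
| "rule_inst NegBoxL
     [Box |`| \<Gamma>\<^sub>1 |\<union>| Neg |`| Dia |`| \<Gamma>\<^sub>2 \<Rrightarrow> finsert \<alpha> (Dia |`| \<Delta>\<^sub>1 |\<union>| Neg |`| Box |`| \<Delta>\<^sub>2)]
     (finsert (\<^bold>\<not>\<box>\<alpha>) (Box |`| \<Gamma>\<^sub>1 |\<union>| Neg |`| Dia |`| \<Gamma>\<^sub>2) \<Rrightarrow> Dia |`| \<Delta>\<^sub>1 |\<union>| Neg |`| Box |`| \<Delta>\<^sub>2)"
| "rule_inst NegBoxR
     [finsert \<alpha> \<Gamma> \<Rrightarrow> \<Delta>]
     (\<Gamma> \<Rrightarrow> finsert (\<^bold>\<not>\<box>\<alpha>) \<Delta>)"
| "rule_inst NegDiaL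
     [\<Gamma> \<Rrightarrow> finsert \<alpha> \<Delta>]
     (finsert (\<^bold>\<not>\<diamond>\<alpha>) \<Gamma> \<Rrightarrow> \<Delta>)"
| "rule_inst NegDiaR
     [finsert \<alpha> (Box |`| \<Gamma>\<^sub>1 |\<union>| Neg |`| Dia |`| \<Gamma>\<^sub>2) \<Rrightarrow> Dia |`| \<Delta>\<^sub>1 |\<union>| Neg |`| Box |`| \<Delta>\<^sub>2]
     (Box |`| \<Gamma>\<^sub>1 |\<union>| Neg |`| Dia |`| \<Gamma>\<^sub>2 \<Rrightarrow> finsert (\<^bold>\<not>\<diamond>\<alpha>) (Dia |`| \<Delta>\<^sub>1 |\<union>| Neg |`| Box |`| \<Delta>\<^sub>2))"
| "rule_inst BoxRT
     [Box |`| \<Gamma>\<^sub>1 |\<union>| Box |`| \<Delta>\<^sub>2 \<Rrightarrow> finsert \<alpha> (Dia |`| \<Delta>\<^sub>1 |\<union>| Dia |`| \<Gamma>\<^sub>2)]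
     (Box |`| \<Gamma>\<^sub>1 |\<union>| Neg |`| Dia |`| \<Gamma>\<^sub>2 \<Rrightarrow> finsert (\<box>\<alpha>) (Dia |`| \<Delta>\<^sub>1 |\<union>| Neg |`| Box |`| \<Delta>\<^sub>2))"
| "rule_inst DiaLT
     [finsert \<alpha> (Box |`| \<Gamma>\<^sub>1 |\<union>| Box |`| \<Delta>\<^sub>2) \<Rrightarrow> Dia |`| \<Delta>\<^sub>1 |\<union>| Dia |`| \<Gamma>\<^sub>2]
     (finsert (\<diamond>\<alpha>) (Box |`| \<Gamma>\<^sub>1 |\<union>| Neg |`| Dia |`| \<Gamma>\<^sub>2) \<Rrightarrow> Dia |`| \<Delta>\<^sub>1 |\<union>| Neg |`| Box |`| \<Delta>\<^sub>2)"
| "rule_inst NegBoxLT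
     [Box |`| \<Gamma>\<^sub>1 |\<union>| Box |`| \<Delta>\<^sub>2 \<Rrightarrow> finsert \<alpha> (Dia |`| \<Delta>\<^sub>1 |\<union>| Dia |`| \<Gamma>\<^sub>2)]
     (finsert (\<^bold>\<not>\<box>\<alpha>) (Box |`| \<Gamma>\<^sub>1 |\<union>| Neg |`| Dia |`| \<Gamma>\<^sub>2) \<Rrightarrow> Dia |`| \<Delta>\<^sub>1 |\<union>| Neg |`| Box |`| \<Delta>\<^sub>2)"
| "rule_inst NegDiaRT
     [finsert \<alpha> (Box |`| \<Gamma>\<^sub>1 |\<union>| Box |`| \<Delta>\<^sub>2) \<Rrightarrow> Dia |`| \<Delta>\<^sub>1 |\<union>| Dia |`| \<Gamma>\<^sub>2]
     (Box |`| \<Gamma>\<^sub>1 |\<union>| Neg |`| Dia |`| \<Gamma>\<^sub>2 \<Rrightarrow> finsert (\<^bold>\<not>\<diamond>\<alpha>) (Dia |`| \<Delta>\<^sub>1 |\<union>| Neg |`| Box |`| \<Delta>\<^sub>2))"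

definition lTS4 :: "rule_name set" where
  "lTS4 = UNIV - {BoxRT, DiaLT, NegBoxLT, NegDiaRT}"

definition gTS4 :: "rule_name set" where
  "gTS4 = (lTS4 - {BoxR, DiaL, NegBoxL, NegDiaR}) \<union> {BoxRT, DiaLT, NegBoxLT, NegDiaRT}"

definition cut_free :: "rule_name set \<Rightarrow> rule_name set" where
  "cut_free L = L - {Cut}"

inductive provable :: "rule_name set \<Rightarrow> sequent \<Rightarrow> bool" for M where
  initial: "initial S \<Longrightarrow> provable M S"
| rule: "r \<in> M \<Longrightarrow> rule_inst r Ps S \<Longrightarrow> \<forall>P \<in> set Ps. provable M P \<Longrightarrow> provable M S"

definition admissible :: "(sequent list \<Rightarrow> sequent \<Rightarrow> bool) \<Rightarrow> rule_name set \<Rightarrow> bool" where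
  "admissible R M \<longleftrightarrow>
     (\<forall>Ps S. R Ps S \<longrightarrow> (\<forall>P \<in> set Ps. provable M P) \<longrightarrow> provable M S)"

inductive neg_left_inv :: "sequent list \<Rightarrow> sequent \<Rightarrow> bool" where
  "neg_left_inv [\<Gamma> \<Rrightarrow> finsert (\<^bold>\<not>\<alpha>) \<Delta>] (finsert \<alpha> \<Gamma> \<Rrightarrow> \<Delta>)"

inductive neg_right_inv :: "sequent list \<Rightarrow> sequent \<Rightarrow> bool" where
  "neg_right_inv [finsert (\<^bold>\<not>\<alpha>) \<Gamma> \<Rrightarrow> \<Delta>] (\<Gamma> \<Rrightarrow> finsert \<alpha> \<Delta>)"

end

theory Submission
  imports Defs
begin

text \<open>
  Read a sequent as a set of signed formulas, the antecedent positive and the succedent negative,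
  and strip leading negations while flipping the sign; the premise and the conclusion of
  (\<open>\<not>\<close>left\<open>\<^sup>-\<^sup>1\<close>) and (\<open>\<not>\<close>right\<open>\<^sup>-\<^sup>1\<close>) have the same stripped set. So it suffices that cut-free
  provability of a sequent depends, monotonically, only on its stripped set. This follows by
  induction on derivations, as every inference acts on stripped sets like one of ten
  negation-free ones, and each of those can be carried out on the formula itself by its non-twist
  rule and on its negation, on the other side, by its twist rule. Hence all four negation rules have
  to be treated at once: inverting at \<open>\<not>\<not>\<alpha>\<close> already requires introducing \<open>\<not>\<alpha>\<close>.
\<close>

section \<open>Stripped sequents as sets of signed formulas\<close>

fun strip :: "bool \<Rightarrow> fm \<Rightarrow> bool \<times> fm" where
  "strip b (\<^bold>\<not>\<alpha>) = strip (\<not> b) \<alpha>"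
| "strip b \<alpha> = (b, \<alpha>)"

fun stripped :: "sequent \<Rightarrow> (bool \<times> fm) set" where
  "stripped (\<Gamma> \<Rrightarrow> \<Delta>) = strip True ` fset \<Gamma> \<union> strip False ` fset \<Delta>"

text \<open>The common stripped form of the contexts that the modal rules demand:
  \<open>Box \<gamma>\<close> on the left and its negation on the right give the same signed
  formula, and dually for \<open>Dia\<close>, so two sets replace the four of the rules.\<close>

definition modal_context :: "fm fset \<Rightarrow> fm fset \<Rightarrow> (bool \<times> fm) set" where
  "modal_context G D = (\<lambda>\<gamma>. (True, \<box>\<gamma>)) ` fset G \<union> (\<lambda>\<delta>. (False, \<diamond>\<delta>)) ` fset D"

lemma stripped_finsert:
  "stripped (finsert \<alpha> \<Gamma> \<Rrightarrow> \<Delta>) = insert (strip True \<alpha>) (stripped (\<Gamma> \<Rrightarrow> \<Delta>))"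
  "stripped (\<Gamma> \<Rrightarrow> finsert \<alpha> \<Delta>) = insert (strip False \<alpha>) (stripped (\<Gamma> \<Rrightarrow> \<Delta>))"
  by auto

text \<open>The gTS4 premises only move negated context members across the arrow and drop their
  negation, which stripping cannot see; this lets both calculi share one argument. Relative to the
  rules, \<open>G\<^sub>2\<close> is their \<Delta>-set with index 2, and \<open>D\<^sub>2\<close>
  their \<Gamma>-set with index 2.\<close>

lemma stripped_modal:
  "stripped (Box |`| G\<^sub>1 |\<union>| Neg |`| Dia |`| D\<^sub>2 \<Rrightarrow> Dia |`| D\<^sub>1 |\<union>| Neg |`| Box |`| G\<^sub>2)
    = modal_context (G\<^sub>1 |\<union>| G\<^sub>2) (D\<^sub>1 |\<union>| D\<^sub>2)"
  "stripped (Box |`| G\<^sub>1 |\<union>| Box |`| G\<^sub>2 \<Rrightarrow> Dia |`| D\<^sub>1 |\<union>| Dia |`| D\<^sub>2)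
    = modal_context (G\<^sub>1 |\<union>| G\<^sub>2) (D\<^sub>1 |\<union>| D\<^sub>2)"
  by (auto simp: modal_context_def image_Un image_image)

section \<open>Recovering formulas from their stripped form\<close>

text \<open>Negations come in pairs because the double negation rules add two at a time without
  changing sides; an odd prefix over \<alpha> is an even one over
  \<open>Neg \<alpha>\<close>.\<close>

inductive double_neg :: "fm \<Rightarrow> fm \<Rightarrow> bool" for \<alpha> where
  refl: "double_neg \<alpha> \<alpha>"
| step: "double_neg \<alpha> \<beta> \<Longrightarrow> double_neg \<alpha> (\<^bold>\<not>\<^bold>\<not>\<beta>)"

text \<open>The sign survives stripping exactly when an even number of negations is removed.
  Removing two restores the sign, so the induction on size descends two negations at once.\<close>

lemma strip_double_neg:
  "(strip b \<beta> = (b, \<alpha>) \<longrightarrow> double_neg \<alpha> \<beta>) \<and>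
   (strip (\<not> b) \<beta> = (b, \<alpha>) \<longrightarrow> double_neg (\<^bold>\<not>\<alpha>) \<beta>)"
proof (induction "size \<beta>" arbitrary: \<beta> rule: less_induct)
  case less
  show ?case
  proof (cases \<beta>)
    case (Neg \<gamma>)
    show ?thesis
    proof (cases \<gamma>)
      case (Neg \<delta>)
      have "size \<delta> < size \<beta>"
        using \<open>\<beta> = \<^bold>\<not>\<gamma>\<close> Neg by simp
      then show ?thesis
        using less[of \<delta>] \<open>\<beta> = \<^bold>\<not>\<gamma>\<close> Neg by (auto intro: double_neg.step)
    qed (use Neg in \<open>auto intro: double_neg.refl\<close>)
  qed (auto intro: double_neg.refl)
qed

text \<open>The two alternatives are the places where \<phi> may have come from: the first is served
  by a non-twist rule, the second by a twist rule.\<close>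

lemma True_in_stripped_cases:
  assumes "(True, \<phi>) \<in> stripped (\<Gamma> \<Rrightarrow> \<Delta>)"
  obtains x where "x |\<in>| \<Gamma>" "double_neg \<phi> x"
        | x where "x |\<in>| \<Delta>" "double_neg (\<^bold>\<not>\<phi>) x"
proof -
  from assms consider x where "x |\<in>| \<Gamma>" "strip True x = (True, \<phi>)"
    | x where "x |\<in>| \<Delta>" "strip False x = (True, \<phi>)"
    by fastforce
  then show thesis
    using strip_double_neg[of True _ \<phi>] that by cases auto
qed

lemma False_in_stripped_cases:
  assumes "(False, \<phi>) \<in> stripped (\<Gamma> \<Rrightarrow> \<Delta>)"
  obtains x where "x |\<in>| \<Delta>" "double_neg \<phi> x"
        | x where "x |\<in>| \<Gamma>" "double_neg (\<^bold>\<not>\<phi>) x"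
proof -
  from assms consider x where "x |\<in>| \<Delta>" "strip False x = (False, \<phi>)"
    | x where "x |\<in>| \<Gamma>" "strip True x = (False, \<phi>)"
    by fastforce
  then show thesis
    using strip_double_neg[of False _ \<phi>] that by cases auto
qed

lemma provable_rule1:
  "rule_inst r [P] S \<Longrightarrow> r \<in> M \<Longrightarrow> provable M P \<Longrightarrow> provable M S"
  by (rule provable.rule) auto

lemma provable_rule2:
  "rule_inst r [P, Q] S \<Longrightarrow> r \<in> M \<Longrightarrow> provable M P \<Longrightarrow> provable M Q \<Longrightarrow> provable M S"
  by (rule provable.rule) auto

section \<open>Provability as a property of stripped sets\<close>

text \<open>The strengthened induction claim. Ranging over all sequents that strip to a superset of
  \<open>X\<close> builds in both weakening and indifference to the side on which a negation is
  placed.\<close>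

definition derivable :: "rule_name set \<Rightarrow> (bool \<times> fm) set \<Rightarrow> bool" where
  "derivable M X \<longleftrightarrow> (\<forall>S. X \<subseteq> stripped S \<longrightarrow> provable M S)"

lemma derivableD: "derivable M X \<Longrightarrow> X \<subseteq> stripped S \<Longrightarrow> provable M S"
  by (simp add: derivable_def)

lemma derivableI:
  assumes "\<And>\<Gamma> \<Delta>. X \<subseteq> stripped (\<Gamma> \<Rrightarrow> \<Delta>) \<Longrightarrow> provable M (\<Gamma> \<Rrightarrow> \<Delta>)"
  shows "derivable M X"
  unfolding derivable_def using assms by (metis sequent.exhaust)

lemma derivable_mono: "derivable M X \<Longrightarrow> X \<subseteq> Y \<Longrightarrow> derivable M Y"
  by (auto simp: derivable_def)

section \<open>Weakening and absorption in the cut-free calculi\<close>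

context
  fixes M :: "rule_name set"
  assumes M: "M = cut_free lTS4 \<or> M = cut_free gTS4"
begin

lemma common_rule:
  "r \<notin> {Cut, BoxR, DiaL, NegBoxL, NegDiaR, BoxRT, DiaLT, NegBoxLT, NegDiaRT} \<Longrightarrow> r \<in> M"
  using M by (auto simp: cut_free_def lTS4_def gTS4_def)

lemma provable_weaken_left: "provable M (\<Gamma> \<Rrightarrow> \<Delta>) \<Longrightarrow> provable M (\<Gamma>' |\<union>| \<Gamma> \<Rrightarrow> \<Delta>)"
  by (induction \<Gamma>') (auto intro: provable_rule1[OF rule_inst.intros(2)] common_rule)

lemma provable_weaken_right: "provable M (\<Gamma> \<Rrightarrow> \<Delta>) \<Longrightarrow> provable M (\<Gamma> \<Rrightarrow> \<Delta>' |\<union>| \<Delta>)"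
  by (induction \<Delta>') (auto intro: provable_rule1[OF rule_inst.intros(3)] common_rule)

text \<open>Repeated \<open>NegNegL\<close> turns \<phi> into \<open>x\<close>, which then merges
  with the copy of \<open>x\<close> already present, since antecedents are sets.\<close>

lemma provable_absorb_left:
  assumes "double_neg \<phi> x" "x |\<in>| \<Gamma>" "provable M (finsert \<phi> \<Gamma> \<Rrightarrow> \<Delta>)"
  shows "provable M (\<Gamma> \<Rrightarrow> \<Delta>)"
proof -
  have "provable M (finsert x \<Gamma> \<Rrightarrow> \<Delta>)"
    using assms(1,3)
    by induction (auto intro: provable_rule1[OF rule_inst.intros(14)] common_rule)
  with assms(2) show ?thesis
    by (simp add: finsert_absorb)
qed

lemma provable_absorb_right:
  assumes "double_neg \<phi> x" "x |\<in>| \<Delta>" "provable M (\<Gamma> \<Rrightarrow> finsert \<phi> \<Delta>)"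
  shows "provable M (\<Gamma> \<Rrightarrow> \<Delta>)"
proof -
  have "provable M (\<Gamma> \<Rrightarrow> finsert x \<Delta>)"
    using assms(1,3)
    by induction (auto intro: provable_rule1[OF rule_inst.intros(15)] common_rule)
  with assms(2) show ?thesis
    by (simp add: finsert_absorb)
qed

text \<open>Weakening adds the target sequent, after which the original formulas are absorbed one by
  one. This serves the axioms and the modal rules with restricted context, which cannot be applied
  inside an arbitrary sequent.\<close>

lemma provable_double_neg:
  assumes "provable M (\<Gamma>\<^sub>0 \<Rrightarrow> \<Delta>\<^sub>0)"
    and "\<And>\<phi>. \<phi> |\<in>| \<Gamma>\<^sub>0 \<Longrightarrow> \<exists>x. x |\<in>| \<Gamma> \<and> double_neg \<phi> x"
    and "\<And>\<phi>. \<phi> |\<in>| \<Delta>\<^sub>0 \<Longrightarrow> \<exists>x. x |\<in>| \<Delta> \<and> double_neg \<phi> x"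
  shows "provable M (\<Gamma> \<Rrightarrow> \<Delta>)"
proof -
  have "provable M (\<Gamma>\<^sub>0 |\<union>| \<Gamma> \<Rrightarrow> \<Delta>\<^sub>0 |\<union>| \<Delta>)"
    using provable_weaken_left[OF provable_weaken_right[OF assms(1)], of \<Gamma> \<Delta>]
    by (simp add: sup_commute)
  then have "provable M (\<Gamma> \<Rrightarrow> \<Delta>\<^sub>0 |\<union>| \<Delta>)"
    using assms(2)
  proof (induction \<Gamma>\<^sub>0)
    case (insert \<phi> \<Gamma>\<^sub>0)
    then obtain x where "x |\<in>| \<Gamma>" "double_neg \<phi> x"
      by blast
    with insert.prems(1) have "provable M (\<Gamma>\<^sub>0 |\<union>| \<Gamma> \<Rrightarrow> \<Delta>\<^sub>0 |\<union>| \<Delta>)"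
      by (auto intro: provable_absorb_left)
    with insert show ?case
      by blast
  qed simp
  then show ?thesis
    using assms(3)
  proof (induction \<Delta>\<^sub>0)
    case (insert \<phi> \<Delta>\<^sub>0)
    then obtain x where "x |\<in>| \<Delta>" "double_neg \<phi> x"
      by blast
    with insert.prems(1) have "provable M (\<Gamma> \<Rrightarrow> \<Delta>\<^sub>0 |\<union>| \<Delta>)"
      by (auto intro: provable_absorb_right)
    with insert show ?case
      by blast
  qed simp
qed

section \<open>Introducing a signed formula on either side\<close>

text \<open>The signed formula stems from \<phi> on the left or \<open>Neg \<phi>\<close> on the
  right, up to double negations, so both introductions are required. The context is the whole target
  sequent, and the new formula is absorbed into the occurrence there.\<close>

lemma derivable_insert_TrueI:
  assumes "\<And>\<Gamma> \<Delta>. X \<subseteq> stripped (\<Gamma> \<Rrightarrow> \<Delta>) \<Longrightarrow>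
    provable M (finsert \<phi> \<Gamma> \<Rrightarrow> \<Delta>) \<and> provable M (\<Gamma> \<Rrightarrow> finsert (\<^bold>\<not>\<phi>) \<Delta>)"
  shows "derivable M (insert (True, \<phi>) X)"
proof (rule derivableI)
  fix \<Gamma> \<Delta>
  assume *: "insert (True, \<phi>) X \<subseteq> stripped (\<Gamma> \<Rrightarrow> \<Delta>)"
  then have "(True, \<phi>) \<in> stripped (\<Gamma> \<Rrightarrow> \<Delta>)"
    by blast
  then show "provable M (\<Gamma> \<Rrightarrow> \<Delta>)"
    by (rule True_in_stripped_cases)
      (use assms[of \<Gamma> \<Delta>] * in \<open>auto intro: provable_absorb_left provable_absorb_right\<close>)
qed

lemma derivable_insert_FalseI:
  assumes "\<And>\<Gamma> \<Delta>. X \<subseteq> stripped (\<Gamma> \<Rrightarrow> \<Delta>) \<Longrightarrow>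
    provable M (\<Gamma> \<Rrightarrow> finsert \<phi> \<Delta>) \<and> provable M (finsert (\<^bold>\<not>\<phi>) \<Gamma> \<Rrightarrow> \<Delta>)"
  shows "derivable M (insert (False, \<phi>) X)"
proof (rule derivableI)
  fix \<Gamma> \<Delta>
  assume *: "insert (False, \<phi>) X \<subseteq> stripped (\<Gamma> \<Rrightarrow> \<Delta>)"
  then have "(False, \<phi>) \<in> stripped (\<Gamma> \<Rrightarrow> \<Delta>)"
    by blast
  then show "provable M (\<Gamma> \<Rrightarrow> \<Delta>)"
    by (rule False_in_stripped_cases)
      (use assms[of \<Gamma> \<Delta>] * in \<open>auto intro: provable_absorb_left provable_absorb_right\<close>)
qed

section \<open>Propositional connectives\<close>

text \<open>\<open>AndL\<close> and \<open>NegAndR\<close> have the same premise, so a single proof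
  of it yields both required conclusions. The other propositional cases pair a non-twist rule with a
  twist rule in the same way.\<close>

lemma derivable_True_And:
  assumes "derivable M (insert (strip True \<alpha>) (insert (strip True \<beta>) X))"
  shows "derivable M (insert (True, \<alpha> \<^bold>\<and> \<beta>) X)"
proof (rule derivable_insert_TrueI)
  fix \<Gamma> \<Delta>
  assume "X \<subseteq> stripped (\<Gamma> \<Rrightarrow> \<Delta>)"
  then have "provable M (finsert \<alpha> (finsert \<beta> \<Gamma>) \<Rrightarrow> \<Delta>)"
    by (intro derivableD[OF assms]) auto
  then show "provable M (finsert (\<alpha> \<^bold>\<and> \<beta>) \<Gamma> \<Rrightarrow> \<Delta>) \<and>
      provable M (\<Gamma> \<Rrightarrow> finsert (\<^bold>\<not>(\<alpha> \<^bold>\<and> \<beta>)) \<Delta>)"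
    by (auto intro: provable_rule1[OF rule_inst.intros(4)]
        provable_rule1[OF rule_inst.intros(17)] common_rule)
qed

lemma derivable_False_And:
  assumes "derivable M (insert (strip False \<alpha>) X)" "derivable M (insert (strip False \<beta>) X)"
  shows "derivable M (insert (False, \<alpha> \<^bold>\<and> \<beta>) X)"
proof (rule derivable_insert_FalseI)
  fix \<Gamma> \<Delta>
  assume "X \<subseteq> stripped (\<Gamma> \<Rrightarrow> \<Delta>)"
  then have "provable M (\<Gamma> \<Rrightarrow> finsert \<alpha> \<Delta>)" "provable M (\<Gamma> \<Rrightarrow> finsert \<beta> \<Delta>)"
    by (intro derivableD[OF assms(1)] derivableD[OF assms(2)]; auto)+
  then show "provable M (\<Gamma> \<Rrightarrow> finsert (\<alpha> \<^bold>\<and> \<beta>) \<Delta>) \<and>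
      provable M (finsert (\<^bold>\<not>(\<alpha> \<^bold>\<and> \<beta>)) \<Gamma> \<Rrightarrow> \<Delta>)"
    by (auto intro: provable_rule2[OF rule_inst.intros(5)]
        provable_rule2[OF rule_inst.intros(16)] common_rule)
qed

lemma derivable_True_Or:
  assumes "derivable M (insert (strip True \<alpha>) X)" "derivable M (insert (strip True \<beta>) X)"
  shows "derivable M (insert (True, \<alpha> \<^bold>\<or> \<beta>) X)"
proof (rule derivable_insert_TrueI)
  fix \<Gamma> \<Delta>
  assume "X \<subseteq> stripped (\<Gamma> \<Rrightarrow> \<Delta>)"
  then have "provable M (finsert \<alpha> \<Gamma> \<Rrightarrow> \<Delta>)" "provable M (finsert \<beta> \<Gamma> \<Rrightarrow> \<Delta>)"
    by (intro derivableD[OF assms(1)] derivableD[OF assms(2)]; auto)+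
  then show "provable M (finsert (\<alpha> \<^bold>\<or> \<beta>) \<Gamma> \<Rrightarrow> \<Delta>) \<and>
      provable M (\<Gamma> \<Rrightarrow> finsert (\<^bold>\<not>(\<alpha> \<^bold>\<or> \<beta>)) \<Delta>)"
    by (auto intro: provable_rule2[OF rule_inst.intros(6)]
        provable_rule2[OF rule_inst.intros(19)] common_rule)
qed

lemma derivable_False_Or:
  assumes "derivable M (insert (strip False \<alpha>) (insert (strip False \<beta>) X))"
  shows "derivable M (insert (False, \<alpha> \<^bold>\<or> \<beta>) X)"
proof (rule derivable_insert_FalseI)
  fix \<Gamma> \<Delta>
  assume "X \<subseteq> stripped (\<Gamma> \<Rrightarrow> \<Delta>)"
  then have "provable M (\<Gamma> \<Rrightarrow> finsert \<alpha> (finsert \<beta> \<Delta>))"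
    by (intro derivableD[OF assms]) auto
  then show "provable M (\<Gamma> \<Rrightarrow> finsert (\<alpha> \<^bold>\<or> \<beta>) \<Delta>) \<and>
      provable M (finsert (\<^bold>\<not>(\<alpha> \<^bold>\<or> \<beta>)) \<Gamma> \<Rrightarrow> \<Delta>)"
    by (auto intro: provable_rule1[OF rule_inst.intros(7)]
        provable_rule1[OF rule_inst.intros(18)] common_rule)
qed

lemma derivable_True_Imp:
  assumes "derivable M (insert (strip False \<alpha>) X)" "derivable M (insert (strip True \<beta>) X)"
  shows "derivable M (insert (True, \<alpha> \<^bold>\<rightarrow> \<beta>) X)"
proof (rule derivable_insert_TrueI)
  fix \<Gamma> \<Delta>
  assume "X \<subseteq> stripped (\<Gamma> \<Rrightarrow> \<Delta>)"
  then have "provable M (\<Gamma> \<Rrightarrow> finsert \<alpha> \<Delta>)" "provable M (finsert \<beta> \<Gamma> \<Rrightarrow> \<Delta>)"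
    by (intro derivableD[OF assms(1)] derivableD[OF assms(2)]; auto)+
  then show "provable M (finsert (\<alpha> \<^bold>\<rightarrow> \<beta>) \<Gamma> \<Rrightarrow> \<Delta>) \<and>
      provable M (\<Gamma> \<Rrightarrow> finsert (\<^bold>\<not>(\<alpha> \<^bold>\<rightarrow> \<beta>)) \<Delta>)"
    by (auto intro: provable_rule2[OF rule_inst.intros(8)]
        provable_rule2[OF rule_inst.intros(21)] common_rule)
qed

lemma derivable_False_Imp:
  assumes "derivable M (insert (strip True \<alpha>) (insert (strip False \<beta>) X))"
  shows "derivable M (insert (False, \<alpha> \<^bold>\<rightarrow> \<beta>) X)"
proof (rule derivable_insert_FalseI)
  fix \<Gamma> \<Delta>
  assume "X \<subseteq> stripped (\<Gamma> \<Rrightarrow> \<Delta>)"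
  then have "provable M (finsert \<alpha> \<Gamma> \<Rrightarrow> finsert \<beta> \<Delta>)"
    by (intro derivableD[OF assms]) auto
  then show "provable M (\<Gamma> \<Rrightarrow> finsert (\<alpha> \<^bold>\<rightarrow> \<beta>) \<Delta>) \<and>
      provable M (finsert (\<^bold>\<not>(\<alpha> \<^bold>\<rightarrow> \<beta>)) \<Gamma> \<Rrightarrow> \<Delta>)"
    by (auto intro: provable_rule1[OF rule_inst.intros(9)]
        provable_rule1[OF rule_inst.intros(20)] common_rule)
qed

section \<open>Modal rules with arbitrary context\<close>

text \<open>The pair with a common premise is \<open>BoxL\<close> and \<open>NegBoxR\<close>; for
  \<open>Dia\<close> with negative sign it is \<open>DiaR\<close> and \<open>NegDiaL\<close>. All
  four belong to both calculi.\<close>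

lemma derivable_True_Box:
  assumes "derivable M (insert (strip True \<alpha>) X)"
  shows "derivable M (insert (True, \<box>\<alpha>) X)"
proof (rule derivable_insert_TrueI)
  fix \<Gamma> \<Delta>
  assume "X \<subseteq> stripped (\<Gamma> \<Rrightarrow> \<Delta>)"
  then have "provable M (finsert \<alpha> \<Gamma> \<Rrightarrow> \<Delta>)"
    by (intro derivableD[OF assms]) auto
  then show "provable M (finsert (\<box>\<alpha>) \<Gamma> \<Rrightarrow> \<Delta>) \<and> provable M (\<Gamma> \<Rrightarrow> finsert (\<^bold>\<not>\<box>\<alpha>) \<Delta>)"
    by (auto intro: provable_rule1[OF rule_inst.intros(10)]
        provable_rule1[OF rule_inst.intros(23)] common_rule)
qed

lemma derivable_False_Dia:
  assumes "derivable M (insert (strip False \<alpha>) X)"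
  shows "derivable M (insert (False, \<diamond>\<alpha>) X)"
proof (rule derivable_insert_FalseI)
  fix \<Gamma> \<Delta>
  assume "X \<subseteq> stripped (\<Gamma> \<Rrightarrow> \<Delta>)"
  then have "provable M (\<Gamma> \<Rrightarrow> finsert \<alpha> \<Delta>)"
    by (intro derivableD[OF assms]) auto
  then show "provable M (\<Gamma> \<Rrightarrow> finsert (\<diamond>\<alpha>) \<Delta>) \<and> provable M (finsert (\<^bold>\<not>\<diamond>\<alpha>) \<Gamma> \<Rrightarrow> \<Delta>)"
    by (auto intro: provable_rule1[OF rule_inst.intros(13)]
        provable_rule1[OF rule_inst.intros(24)] common_rule)
qed

section \<open>Modal rules with restricted context\<close>

text \<open>Sorts the modal context by where its members occur in the target sequent, so that it
  takes the shape of a rule context whose formulas all have doubly negated counterparts there. The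
  pieces may overlap.\<close>

lemma modal_context_split:
  assumes "modal_context G D \<subseteq> stripped (\<Gamma> \<Rrightarrow> \<Delta>)"
  obtains G\<^sub>1 G\<^sub>2 D\<^sub>1 D\<^sub>2 where "G = G\<^sub>1 |\<union>| G\<^sub>2" "D = D\<^sub>1 |\<union>| D\<^sub>2"
    "\<And>\<phi>. \<phi> |\<in>| Box |`| G\<^sub>1 |\<union>| Neg |`| Dia |`| D\<^sub>2 \<Longrightarrow> \<exists>x. x |\<in>| \<Gamma> \<and> double_neg \<phi> x"
    "\<And>\<phi>. \<phi> |\<in>| Dia |`| D\<^sub>1 |\<union>| Neg |`| Box |`| G\<^sub>2 \<Longrightarrow> \<exists>x. x |\<in>| \<Delta> \<and> double_neg \<phi> x"
proof
  let ?L = "\<lambda>\<phi>. \<exists>x. x |\<in>| \<Gamma> \<and> double_neg \<phi> x"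
  let ?R = "\<lambda>\<phi>. \<exists>x. x |\<in>| \<Delta> \<and> double_neg \<phi> x"
  have "?L (\<box>\<gamma>) \<or> ?R (\<^bold>\<not>\<box>\<gamma>)" if "\<gamma> |\<in>| G" for \<gamma>
  proof -
    have "(True, \<box>\<gamma>) \<in> stripped (\<Gamma> \<Rrightarrow> \<Delta>)"
      using assms that by (auto simp: modal_context_def simp del: stripped.simps)
    then show ?thesis
      by (rule True_in_stripped_cases) blast+
  qed
  \<comment> \<open>The witnesses for \<open>G\<^sub>1\<close> and \<open>G\<^sub>2\<close> are
    these filters: members found as \<open>Box \<gamma>\<close> on the left, and members found as
    its negation on the right.\<close>
  then show "G = ffilter (\<lambda>\<gamma>. ?L (\<box>\<gamma>)) G |\<union>| ffilter (\<lambda>\<gamma>. ?R (\<^bold>\<not>\<box>\<gamma>)) G"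
    by (simp add: fset_eq_iff) blast
  have "?R (\<diamond>\<delta>) \<or> ?L (\<^bold>\<not>\<diamond>\<delta>)" if "\<delta> |\<in>| D" for \<delta>
  proof -
    have "(False, \<diamond>\<delta>) \<in> stripped (\<Gamma> \<Rrightarrow> \<Delta>)"
      using assms that by (auto simp: modal_context_def simp del: stripped.simps)
    then show ?thesis
      by (rule False_in_stripped_cases) blast+
  qed
  then show "D = ffilter (\<lambda>\<delta>. ?R (\<diamond>\<delta>)) D |\<union>| ffilter (\<lambda>\<delta>. ?L (\<^bold>\<not>\<diamond>\<delta>)) D"
    by (simp add: fset_eq_iff) blast
qed auto

text \<open>The rule is applied in exactly the context it allows, and only its conclusion is
  expanded to the target sequent by weakening and double negations.\<close>

lemma derivable_False_Box:
  assumes "derivable M (insert (strip False \<alpha>) (modal_context G D))"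
  shows "derivable M (insert (False, \<box>\<alpha>) (modal_context G D))"
proof (rule derivableI)
  fix \<Gamma> \<Delta>
  assume *: "insert (False, \<box>\<alpha>) (modal_context G D) \<subseteq> stripped (\<Gamma> \<Rrightarrow> \<Delta>)"
  then have "modal_context G D \<subseteq> stripped (\<Gamma> \<Rrightarrow> \<Delta>)"
    by blast
  then obtain G\<^sub>1 G\<^sub>2 D\<^sub>1 D\<^sub>2 where split: "G = G\<^sub>1 |\<union>| G\<^sub>2" "D = D\<^sub>1 |\<union>| D\<^sub>2"
    "\<And>\<phi>. \<phi> |\<in>| Box |`| G\<^sub>1 |\<union>| Neg |`| Dia |`| D\<^sub>2 \<Longrightarrow> \<exists>x. x |\<in>| \<Gamma> \<and> double_neg \<phi> x"
    "\<And>\<phi>. \<phi> |\<in>| Dia |`| D\<^sub>1 |\<union>| Neg |`| Box |`| G\<^sub>2 \<Longrightarrow> \<exists>x. x |\<in>| \<Delta> \<and> double_neg \<phi> x"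
    by (rule modal_context_split) blast
  let ?\<Gamma> = "Box |`| G\<^sub>1 |\<union>| Neg |`| Dia |`| D\<^sub>2" and ?\<Delta> = "Dia |`| D\<^sub>1 |\<union>| Neg |`| Box |`| G\<^sub>2"
  \<comment> \<open>The premises of the lTS4 rules (\<open>l\<close>) and of the gTS4 rules
    (\<open>g\<close>) strip to the same set, so the assumption proves both, whichever calculus
    \<open>M\<close> is.\<close>
  have l: "provable M (?\<Gamma> \<Rrightarrow> finsert \<alpha> ?\<Delta>)"
    by (rule derivableD[OF assms]) (simp add: split(1,2) stripped_finsert stripped_modal del: stripped.simps fset.map_comp)
  have g: "provable M (Box |`| G\<^sub>1 |\<union>| Box |`| G\<^sub>2 \<Rrightarrow> finsert \<alpha> (Dia |`| D\<^sub>1 |\<union>| Dia |`| D\<^sub>2))"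
    by (rule derivableD[OF assms]) (simp add: split(1,2) stripped_finsert stripped_modal del: stripped.simps fset.map_comp)
  from M have right: "provable M (?\<Gamma> \<Rrightarrow> finsert (\<box>\<alpha>) ?\<Delta>)"
  proof
    assume "M = cut_free lTS4"
    then show ?thesis
      by (intro provable_rule1[OF rule_inst.intros(11) _ l]) (simp add: cut_free_def lTS4_def)
  next
    assume "M = cut_free gTS4"
    then show ?thesis
      by (intro provable_rule1[OF rule_inst.intros(26) _ g]) (simp add: cut_free_def gTS4_def)
  qed
  from M have left: "provable M (finsert (\<^bold>\<not>\<box>\<alpha>) ?\<Gamma> \<Rrightarrow> ?\<Delta>)"
  proof
    assume "M = cut_free lTS4"
    then show ?thesis
      by (intro provable_rule1[OF rule_inst.intros(22) _ l]) (simp add: cut_free_def lTS4_def)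
  next
    assume "M = cut_free gTS4"
    then show ?thesis
      by (intro provable_rule1[OF rule_inst.intros(28) _ g]) (simp add: cut_free_def gTS4_def)
  qed
  \<comment> \<open>The side on which \<open>Box \<alpha>\<close> survives in the target decides
    between the right rule and the twist rule on the left.\<close>
  have "(False, \<box>\<alpha>) \<in> stripped (\<Gamma> \<Rrightarrow> \<Delta>)"
    using * by blast
  then show "provable M (\<Gamma> \<Rrightarrow> \<Delta>)"
  proof (rule False_in_stripped_cases)
    fix x assume x: "x |\<in>| \<Delta>" "double_neg (\<box>\<alpha>) x"
    show ?thesis
      by (rule provable_double_neg[OF right], erule split(3), erule finsertE, use x in blast, erule split(4))
  next
    fix x assume x: "x |\<in>| \<Gamma>" "double_neg (\<^bold>\<not>\<box>\<alpha>) x"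
    show ?thesis
      by (rule provable_double_neg[OF left], erule finsertE, use x in blast, erule split(3), erule split(4))
  qed
qed

text \<open>Dual to \<open>derivable_False_Box\<close>: \<open>DiaL\<close> is paired with
  \<open>NegDiaR\<close> in lTS4, and \<open>DiaLT\<close> with \<open>NegDiaRT\<close> in
  gTS4.\<close>

lemma derivable_True_Dia:
  assumes "derivable M (insert (strip True \<alpha>) (modal_context G D))"
  shows "derivable M (insert (True, \<diamond>\<alpha>) (modal_context G D))"
proof (rule derivableI)
  fix \<Gamma> \<Delta>
  assume *: "insert (True, \<diamond>\<alpha>) (modal_context G D) \<subseteq> stripped (\<Gamma> \<Rrightarrow> \<Delta>)"
  then have "modal_context G D \<subseteq> stripped (\<Gamma> \<Rrightarrow> \<Delta>)"
    by blast
  then obtain G\<^sub>1 G\<^sub>2 D\<^sub>1 D\<^sub>2 where split: "G = G\<^sub>1 |\<union>| G\<^sub>2" "D = D\<^sub>1 |\<union>| D\<^sub>2"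
    "\<And>\<phi>. \<phi> |\<in>| Box |`| G\<^sub>1 |\<union>| Neg |`| Dia |`| D\<^sub>2 \<Longrightarrow> \<exists>x. x |\<in>| \<Gamma> \<and> double_neg \<phi> x"
    "\<And>\<phi>. \<phi> |\<in>| Dia |`| D\<^sub>1 |\<union>| Neg |`| Box |`| G\<^sub>2 \<Longrightarrow> \<exists>x. x |\<in>| \<Delta> \<and> double_neg \<phi> x"
    by (rule modal_context_split) blast
  let ?\<Gamma> = "Box |`| G\<^sub>1 |\<union>| Neg |`| Dia |`| D\<^sub>2" and ?\<Delta> = "Dia |`| D\<^sub>1 |\<union>| Neg |`| Box |`| G\<^sub>2"
  have l: "provable M (finsert \<alpha> ?\<Gamma> \<Rrightarrow> ?\<Delta>)"
    by (rule derivableD[OF assms]) (simp add: split(1,2) stripped_finsert stripped_modal del: stripped.simps fset.map_comp)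
  have g: "provable M (finsert \<alpha> (Box |`| G\<^sub>1 |\<union>| Box |`| G\<^sub>2) \<Rrightarrow> Dia |`| D\<^sub>1 |\<union>| Dia |`| D\<^sub>2)"
    by (rule derivableD[OF assms]) (simp add: split(1,2) stripped_finsert stripped_modal del: stripped.simps fset.map_comp)
  from M have left: "provable M (finsert (\<diamond>\<alpha>) ?\<Gamma> \<Rrightarrow> ?\<Delta>)"
  proof
    assume "M = cut_free lTS4"
    then show ?thesis
      by (intro provable_rule1[OF rule_inst.intros(12) _ l]) (simp add: cut_free_def lTS4_def)
  next
    assume "M = cut_free gTS4"
    then show ?thesis
      by (intro provable_rule1[OF rule_inst.intros(27) _ g]) (simp add: cut_free_def gTS4_def)
  qed
  from M have right: "provable M (?\<Gamma> \<Rrightarrow> finsert (\<^bold>\<not>\<diamond>\<alpha>) ?\<Delta>)"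
  proof
    assume "M = cut_free lTS4"
    then show ?thesis
      by (intro provable_rule1[OF rule_inst.intros(25) _ l]) (simp add: cut_free_def lTS4_def)
  next
    assume "M = cut_free gTS4"
    then show ?thesis
      by (intro provable_rule1[OF rule_inst.intros(29) _ g]) (simp add: cut_free_def gTS4_def)
  qed
  have "(True, \<diamond>\<alpha>) \<in> stripped (\<Gamma> \<Rrightarrow> \<Delta>)"
    using * by blast
  then show "provable M (\<Gamma> \<Rrightarrow> \<Delta>)"
  proof (rule True_in_stripped_cases)
    fix x assume x: "x |\<in>| \<Gamma>" "double_neg (\<diamond>\<alpha>) x"
    show ?thesis
      by (rule provable_double_neg[OF left], erule finsertE, use x in blast, erule split(3), erule split(4))
  next
    fix x assume x: "x |\<in>| \<Delta>" "double_neg (\<^bold>\<not>\<diamond>\<alpha>) x"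
    show ?thesis
      by (rule provable_double_neg[OF right], erule split(3), erule finsertE, use x in blast, erule split(4))
  qed
qed

section \<open>Axioms and induction on derivations\<close>

text \<open>Each of the two signed variables can sit on either side, bare or negated; the four
  combinations are exactly the four initial sequents.\<close>

lemma derivable_Var: "derivable M {(True, Var p), (False, Var p)}"
proof (rule derivableI)
  fix \<Gamma> \<Delta>
  assume "{(True, Var p), (False, Var p)} \<subseteq> stripped (\<Gamma> \<Rrightarrow> \<Delta>)"
  then have T: "(True, Var p) \<in> stripped (\<Gamma> \<Rrightarrow> \<Delta>)" and F: "(False, Var p) \<in> stripped (\<Gamma> \<Rrightarrow> \<Delta>)"
    by blast+
  note ax = initial.intros[THEN provable.initial, of M p]
  from T show "provable M (\<Gamma> \<Rrightarrow> \<Delta>)"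
  proof (rule True_in_stripped_cases)
    fix x assume x: "x |\<in>| \<Gamma>" "double_neg (Var p) x"
    from F show ?thesis
      by (rule False_in_stripped_cases)
        (use x in \<open>auto intro: provable_double_neg[OF ax(1)] provable_double_neg[OF ax(3)]\<close>)
  next
    fix x assume x: "x |\<in>| \<Delta>" "double_neg (\<^bold>\<not>Var p) x"
    from F show ?thesis
      by (rule False_in_stripped_cases)
        (use x in \<open>auto intro: provable_double_neg[OF ax(4)] provable_double_neg[OF ax(2)]\<close>)
  qed
qed

text \<open>On stripped sets a twist rule coincides with its non-twist partner, the modal rules of
  lTS4 coincide with those of gTS4, the double negation rules become trivial and weakening is
  monotonicity. Hence \<open>r\<close> may come from either calculus. In a cut the active formula
  has both signs in the premises and may vanish from the conclusion.\<close>

lemma derivable_rule_inst: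
  assumes "rule_inst r Ps S" "r \<noteq> Cut" "\<forall>P \<in> set Ps. derivable M (stripped P)"
  shows "derivable M (stripped S)"
proof -
  note [simp] = stripped_finsert stripped_modal and [simp del] = stripped.simps fset.map_comp
  from assms show ?thesis
  proof cases
    case (2 \<Gamma> \<Delta> \<alpha>)
    with assms(3) have "derivable M (stripped (\<Gamma> \<Rrightarrow> \<Delta>))"
      by simp
    with 2 show ?thesis
      by (auto elim: derivable_mono)
  next
    case (3 \<Gamma> \<Delta> \<alpha>)
    with assms(3) have "derivable M (stripped (\<Gamma> \<Rrightarrow> \<Delta>))"
      by simp
    with 3 show ?thesis
      by (auto elim: derivable_mono)
  qed (use assms(2,3) in \<open>auto intro!: derivable_True_And derivable_False_And
      derivable_True_Or derivable_False_Or derivable_True_Imp derivable_False_Imp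
      derivable_True_Box derivable_False_Box derivable_True_Dia derivable_False_Dia
      simp: insert_commute\<close>)
qed

lemma provable_imp_derivable: "provable M S \<Longrightarrow> derivable M (stripped S)"
proof (induction rule: provable.induct)
  case (initial S)
  then show ?case
    by cases (use derivable_Var in \<open>auto simp: insert_commute\<close>)
next
  case (rule r Ps S)
  moreover have "r \<noteq> Cut"
    using rule.hyps M by (auto simp: cut_free_def)
  ultimately show ?case
    by (auto intro: derivable_rule_inst)
qed

text \<open>The inverse negation rules are instances: moving \<alpha> across the arrow while
  dropping its negation leaves the stripped set unchanged.\<close>

lemma provable_stripped_eq: "provable M S \<Longrightarrow> stripped S = stripped S' \<Longrightarrow> provable M S'"
  using provable_imp_derivable derivableD by blast

end

theorem theorem4p2:
  fixes L :: "rule_name set"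
  assumes "L = lTS4 \<or> L = gTS4"
  shows "admissible neg_left_inv (cut_free L) \<and> admissible neg_right_inv (cut_free L)"
proof -
  have M: "cut_free L = cut_free lTS4 \<or> cut_free L = cut_free gTS4"
    using assms by blast
  show ?thesis
    unfolding admissible_def
    by (auto elim!: neg_left_inv.cases neg_right_inv.cases provable_stripped_eq[OF M])
qed

end
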